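(* Let $C$ and $D$ be categories, let $\gamma$ be a functor with domain $C$, and let $a,b\in\mathrm{ob}(C)$. Let $\delta$ be a functor with domain $D$ and let $d_1,d_2\in\mathrm{ob}(D)$. If $\gamma$ at $a,b$ is modeled by $\delta$ at $d_1,d_2$, and $\delta$ fulfills (P) at $d_1,d_2$, then $\gamma$ fulfills (P) at $a,b$.
   Context: For a category $C$, $\mathrm{ob}(C)$ is the class of objects and $\hom(a,b)$ is the class of morphisms of $C$ from $a$ to $b$; composition is written $g\cdot f$ (for $f\in\hom(a,b)$, $g\in\hom(b,c)$, $g\cdot f\in\hom(a,c)$). $\mathbb N$ includes $0$. For $r\in\mathbb N$, an $r$-coloring of a set $X$ is a function on $X$ with at most $r$ values. Condition (P). Let $\delta$ be a functor defined on a category $C$ and let $a,b\in \mathrm{ob}(C)$. The functor $\delta$ fulfills (P) at $a,b$ if for each $r\in\mathbb N$ there exists $c\in \mathrm{ob}(C)$ such that for each $r$-coloring $\chi$ of $\hom(a,c)$ there exists $g\in\hom(b,c)$ such that for all $f_1,f_2\in\hom(a,b)$: $\delta(f_1)=\delta(f_2)$ implies $\chi(g\cdot f_1)=\chi(g\cdot f_2)$. Cross-relatedness. Let $C,D$ be categories, $c_1,c_2,c_3\in\mathrm{ob}(C)$ and $d_1,d_2,d_3\in\mathrm{ob}(D)$. The triples $c_1,c_2,c_3$ and $d_1,d_2,d_3$ are cross-related by $(\phi,\psi)$, where $\phi\colon\hom(c_1,c_2)\times\hom(d_2,d_3)\to\hom(d_1,d_2)$ and $\psi\colon\hom(d_2,d_3)\to\hom(c_2,c_3)$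 are functions, if there is a function $\zeta\colon\hom(d_1,d_3)\to\hom(c_1,c_3)$ such that $\zeta(g\cdot\phi(f,g))=\psi(g)\cdot f$ for all $(f,g)\in\hom(c_1,c_2)\times\hom(d_2,d_3)$. Modeling. Let $\gamma\colon C\to E$ and $\delta\colon D\to F$ be functors, $c_1,c_2\in\mathrm{ob}(C)$ and $d_1,d_2\in\mathrm{ob}(D)$. We say that $\gamma$ at $c_1,c_2$ is modeled by $\delta$ at $d_1,d_2$ if for each $d_3\in\mathrm{ob}(D)$ there is $c_3\in\mathrm{ob}(C)$ so that $c_1,c_2,c_3$ and $d_1,d_2,d_3$ are cross-related by some $(\phi,\psi)$ such that, for all $f,f'\in\hom(c_1,c_2)$ and $g\in\hom(d_2,d_3)$, $\gamma(f)=\gamma(f')$ implies $\delta(\phi(f,g))=\delta(\phi(f',g))$. *)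

theory Defs
  imports Main "HOL-Library.FuncSet"
begin

record ('o, 'm) cat =
  Ob :: "'o set"
  Arr :: "'m set"
  Dom :: "'m \<Rightarrow> 'o"
  Cod :: "'m \<Rightarrow> 'o"
  Idn :: "'o \<Rightarrow> 'm"
  Comp :: "'m \<Rightarrow> 'm \<Rightarrow> 'm" (infixl \<open>\<cdot>\<index>\<close> 70)

definition hom :: "('o, 'm) cat \<Rightarrow> 'o \<Rightarrow> 'o \<Rightarrow> 'm set" where
  "hom C a b = {f \<in> Arr C. Dom C f = a \<and> Cod C f = b}"

locale category =
  fixes C :: "('o, 'm) cat" (structure)
  assumes Dom_in: "f \<in> Arr C \<Longrightarrow> Dom C f \<in> Ob C"
    and Cod_in: "f \<in> Arr C \<Longrightarrow> Cod C f \<in> Ob C"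
    and Idn_in: "a \<in> Ob C \<Longrightarrow> Idn C a \<in> hom C a a"
    and Comp_in: "\<lbrakk>f \<in> hom C a b; g \<in> hom C b c\<rbrakk> \<Longrightarrow> g \<cdot> f \<in> hom C a c"
    and Comp_Idn: "f \<in> hom C a b \<Longrightarrow> f \<cdot> Idn C a = f"
    and Idn_Comp: "f \<in> hom C a b \<Longrightarrow> Idn C b \<cdot> f = f"
    and Comp_assoc:
      "\<lbrakk>f \<in> hom C a b; g \<in> hom C b c; h \<in> hom C c d\<rbrakk> \<Longrightarrow> (h \<cdot> g) \<cdot> f = h \<cdot> (g \<cdot> f)"

record ('o, 'm, 'p, 'n) func =
  on_Ob :: "'o \<Rightarrow> 'p"
  on_Arr :: "'m \<Rightarrow> 'n"

locale cat_functor = dom: category C + cod: category E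
  for C :: "('o, 'm) cat" and E :: "('p, 'n) cat" +
  fixes \<gamma> :: "('o, 'm, 'p, 'n) func"
  assumes on_Ob_in: "a \<in> Ob C \<Longrightarrow> on_Ob \<gamma> a \<in> Ob E"
    and on_Arr_in: "f \<in> hom C a b \<Longrightarrow> on_Arr \<gamma> f \<in> hom E (on_Ob \<gamma> a) (on_Ob \<gamma> b)"
    and on_Idn: "a \<in> Ob C \<Longrightarrow> on_Arr \<gamma> (Idn C a) = Idn E (on_Ob \<gamma> a)"
    and on_Comp: "\<lbrakk>f \<in> hom C a b; g \<in> hom C b c\<rbrakk>
      \<Longrightarrow> on_Arr \<gamma> (g \<cdot>\<^bsub>C\<^esub> f) = on_Arr \<gamma> g \<cdot>\<^bsub>E\<^esub> on_Arr \<gamma> f"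

definition coloring :: "nat \<Rightarrow> 'a set \<Rightarrow> ('a \<Rightarrow> 'k) \<Rightarrow> bool" where
  "coloring r X \<chi> \<longleftrightarrow> finite (\<chi> ` X) \<and> card (\<chi> ` X) \<le> r"

text \<open>
  A definition cannot quantify over types of colors, so colors are natural numbers below.
  As only finitely many colors occur, this is no restriction: see \<open>fulfills_PD\<close>.
\<close>

definition fulfills_P ::
  "('o, 'm) cat \<Rightarrow> ('o, 'm, 'p, 'n) func \<Rightarrow> 'o \<Rightarrow> 'o \<Rightarrow> bool" where
  "fulfills_P C \<delta> a b \<longleftrightarrow>
    (\<forall>r. \<exists>c\<in>Ob C. \<forall>\<chi> :: 'm \<Rightarrow> nat. coloring r (hom C a c) \<chi> \<longrightarrow>
      (\<exists>g\<in>hom C b c. \<forall>f1\<in>hom C a b. \<forall>f2\<in>hom C a b.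
        on_Arr \<delta> f1 = on_Arr \<delta> f2 \<longrightarrow> \<chi> (g \<cdot>\<^bsub>C\<^esub> f1) = \<chi> (g \<cdot>\<^bsub>C\<^esub> f2)))"

lemma (in category) fulfills_PD:
  fixes r :: nat
  assumes "fulfills_P C \<delta> a b"
  shows "\<exists>c\<in>Ob C. \<forall>\<chi> :: 'm \<Rightarrow> 'k. coloring r (hom C a c) \<chi> \<longrightarrow>
      (\<exists>g\<in>hom C b c. \<forall>f1\<in>hom C a b. \<forall>f2\<in>hom C a b.
        on_Arr \<delta> f1 = on_Arr \<delta> f2 \<longrightarrow> \<chi> (g \<cdot> f1) = \<chi> (g \<cdot> f2))"
proof -
  obtain c where c: "c \<in> Ob C"
    and P: "\<And>\<chi> :: 'm \<Rightarrow> nat. coloring r (hom C a c) \<chi> \<Longrightarrow>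
      \<exists>g\<in>hom C b c. \<forall>f1\<in>hom C a b. \<forall>f2\<in>hom C a b.
        on_Arr \<delta> f1 = on_Arr \<delta> f2 \<longrightarrow> \<chi> (g \<cdot> f1) = \<chi> (g \<cdot> f2)"
    using assms unfolding fulfills_P_def by meson
  have "\<exists>g\<in>hom C b c. \<forall>f1\<in>hom C a b. \<forall>f2\<in>hom C a b.
        on_Arr \<delta> f1 = on_Arr \<delta> f2 \<longrightarrow> \<chi> (g \<cdot> f1) = \<chi> (g \<cdot> f2)"
    if \<chi>: "coloring r (hom C a c) \<chi>" for \<chi> :: "'m \<Rightarrow> 'k"
  proof -
    let ?K = "\<chi> ` hom C a c"
    have fin: "finite ?K" and card: "card ?K \<le> r"
      using \<chi> by (auto simp: coloring_def)
    obtain e :: "'k \<Rightarrow> nat" where e: "inj_on e ?K"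
      using finite_imp_inj_to_nat_seg[OF fin] by blast
    have "coloring r (hom C a c) (e \<circ> \<chi>)"
      unfolding coloring_def image_comp[symmetric]
      using fin card card_image_le[OF fin, of e] by auto
    from P[OF this] obtain g where g: "g \<in> hom C b c"
      and eq: "\<And>f1 f2. \<lbrakk>f1 \<in> hom C a b; f2 \<in> hom C a b; on_Arr \<delta> f1 = on_Arr \<delta> f2\<rbrakk>
        \<Longrightarrow> e (\<chi> (g \<cdot> f1)) = e (\<chi> (g \<cdot> f2))"
      by auto
    show ?thesis
    proof (intro bexI[OF _ g] ballI impI)
      fix f1 f2
      assume f: "f1 \<in> hom C a b" "f2 \<in> hom C a b" "on_Arr \<delta> f1 = on_Arr \<delta> f2"
      show "\<chi> (g \<cdot> f1) = \<chi> (g \<cdot> f2)"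
        using inj_onD[OF e eq[OF f]] Comp_in[OF f(1) g] Comp_in[OF f(2) g] by simp
    qed
  qed
  with c show ?thesis by blast
qed

definition cross_related ::
  "('o, 'm) cat \<Rightarrow> ('p, 'n) cat \<Rightarrow> 'o \<Rightarrow> 'o \<Rightarrow> 'o \<Rightarrow> 'p \<Rightarrow> 'p \<Rightarrow> 'p
    \<Rightarrow> ('m \<times> 'n \<Rightarrow> 'n) \<Rightarrow> ('n \<Rightarrow> 'm) \<Rightarrow> bool" where
  "cross_related C D c1 c2 c3 d1 d2 d3 \<phi> \<psi> \<longleftrightarrow>
    \<phi> \<in> hom C c1 c2 \<times> hom D d2 d3 \<rightarrow> hom D d1 d2 \<and>
    \<psi> \<in> hom D d2 d3 \<rightarrow> hom C c2 c3 \<and>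
    (\<exists>\<zeta> \<in> hom D d1 d3 \<rightarrow> hom C c1 c3.
      \<forall>(f, g) \<in> hom C c1 c2 \<times> hom D d2 d3. \<zeta> (g \<cdot>\<^bsub>D\<^esub> \<phi> (f, g)) = \<psi> g \<cdot>\<^bsub>C\<^esub> f)"

definition modeled_by ::
  "('o, 'm) cat \<Rightarrow> ('o, 'm, 'o1, 'm1) func \<Rightarrow> 'o \<Rightarrow> 'o
    \<Rightarrow> ('p, 'n) cat \<Rightarrow> ('p, 'n, 'p1, 'n1) func \<Rightarrow> 'p \<Rightarrow> 'p \<Rightarrow> bool" where
  "modeled_by C \<gamma> c1 c2 D \<delta> d1 d2 \<longleftrightarrow>
    (\<forall>d3\<in>Ob D. \<exists>c3\<in>Ob C. \<exists>\<phi> \<psi>. cross_related C D c1 c2 c3 d1 d2 d3 \<phi> \<psi> \<and>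
      (\<forall>f\<in>hom C c1 c2. \<forall>f'\<in>hom C c1 c2. \<forall>g\<in>hom D d2 d3.
        on_Arr \<gamma> f = on_Arr \<gamma> f' \<longrightarrow> on_Arr \<delta> (\<phi> (f, g)) = on_Arr \<delta> (\<phi> (f', g))))"

end

theory Submission
  imports Defs
begin

text \<open>Colorings are pulled back along \<zeta>. Given \<open>r\<close>, let \<open>d3\<close>
  witness (P) for \<delta>, and let \<open>c3\<close>, \<phi>, \<psi>, \<zeta> come from the
  modeling. A coloring \<chi> of \<open>hom C a c3\<close> yields the coloring
  \<open>\<chi> \<circ> \<zeta>\<close> of \<open>hom D d1 d3\<close>, which uses no new colors
  (\<open>coloring_compose\<close>). For the \<open>g\<close> that (P) supplies for it, \<psi>
  \<open>g\<close> is the morphism sought: cross-relatedness turns the color of \<psi>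
  \<open>g\<close> composed with \<open>f\<close> into the pulled-back color of \<open>g\<close>
  composed with \<phi> \<open>(f, g)\<close>, and the latter depends only on the \<delta>-value of
  \<phi> \<open>(f, g)\<close>, hence only on the \<gamma>-value of \<open>f\<close>.\<close>

lemma coloring_compose:
  assumes "coloring r Y \<chi>" and "\<zeta> \<in> X \<rightarrow> Y"
  shows "coloring r X (\<chi> \<circ> \<zeta>)"
proof -
  have sub: "(\<chi> \<circ> \<zeta>) ` X \<subseteq> \<chi> ` Y"
    using assms(2) by auto
  then show ?thesis
    using assms(1) finite_subset[OF sub] card_mono[OF _ sub]
    unfolding coloring_def by linarith
qed

theorem theorem13:
  fixes C :: "('o, 'm) cat" and E :: "('o1, 'm1) cat"
    and D :: "('p, 'n) cat" and F :: "('p1, 'n1) cat"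
    and \<gamma> :: "('o, 'm, 'o1, 'm1) func" and \<delta> :: "('p, 'n, 'p1, 'n1) func"
    and a b :: 'o and d1 d2 :: 'p
  assumes "category C" and "category D" and "category E" and "category F"
    and "cat_functor C E \<gamma>" and "cat_functor D F \<delta>"
    and "a \<in> Ob C" and "b \<in> Ob C" and "d1 \<in> Ob D" and "d2 \<in> Ob D"
    and "modeled_by C \<gamma> a b D \<delta> d1 d2"
    and "fulfills_P D \<delta> d1 d2"
  shows "fulfills_P C \<gamma> a b"
proof -
  have "\<exists>c\<in>Ob C. \<forall>\<chi> :: 'm \<Rightarrow> nat. coloring r (hom C a c) \<chi> \<longrightarrow>
      (\<exists>g\<in>hom C b c. \<forall>f1\<in>hom C a b. \<forall>f2\<in>hom C a b.
        on_Arr \<gamma> f1 = on_Arr \<gamma> f2 \<longrightarrow> \<chi> (g \<cdot>\<^bsub>C\<^esub> f1) = \<chi> (g \<cdot>\<^bsub>C\<^esub> f2))" for r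
  proof -
    obtain d3 where d3: "d3 \<in> Ob D"
      and P: "\<And>\<chi> :: 'n \<Rightarrow> nat. coloring r (hom D d1 d3) \<chi> \<Longrightarrow>
        \<exists>g\<in>hom D d2 d3. \<forall>h1\<in>hom D d1 d2. \<forall>h2\<in>hom D d1 d2.
          on_Arr \<delta> h1 = on_Arr \<delta> h2 \<longrightarrow> \<chi> (g \<cdot>\<^bsub>D\<^esub> h1) = \<chi> (g \<cdot>\<^bsub>D\<^esub> h2)"
      using \<open>fulfills_P D \<delta> d1 d2\<close> unfolding fulfills_P_def by meson
    \<comment> \<open>The object \<open>c3\<close> depends on \<open>d3\<close>, thus on
      \<open>r\<close>, but on no coloring, as the order of quantifiers in (P) demands.\<close>
    obtain c3 \<phi> \<psi> where c3: "c3 \<in> Ob C"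
      and cross: "cross_related C D a b c3 d1 d2 d3 \<phi> \<psi>"
      and compat: "\<And>f f' g. \<lbrakk>f \<in> hom C a b; f' \<in> hom C a b; g \<in> hom D d2 d3;
        on_Arr \<gamma> f = on_Arr \<gamma> f'\<rbrakk> \<Longrightarrow> on_Arr \<delta> (\<phi> (f, g)) = on_Arr \<delta> (\<phi> (f', g))"
      using \<open>modeled_by C \<gamma> a b D \<delta> d1 d2\<close> d3 unfolding modeled_by_def by meson
    have \<phi>: "\<phi> (f, g) \<in> hom D d1 d2" if "f \<in> hom C a b" "g \<in> hom D d2 d3" for f g
      using cross that by (auto simp: cross_related_def)
    have \<psi>: "\<psi> g \<in> hom C b c3" if "g \<in> hom D d2 d3" for g
      using cross that by (auto simp: cross_related_def)
    obtain \<zeta> where \<zeta>: "\<zeta> \<in> hom D d1 d3 \<rightarrow> hom C a c3"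
      and \<zeta>_eq: "\<And>f g. \<lbrakk>f \<in> hom C a b; g \<in> hom D d2 d3\<rbrakk>
        \<Longrightarrow> \<zeta> (g \<cdot>\<^bsub>D\<^esub> \<phi> (f, g)) = \<psi> g \<cdot>\<^bsub>C\<^esub> f"
      using cross by (auto simp: cross_related_def)
    have "\<exists>g\<in>hom C b c3. \<forall>f1\<in>hom C a b. \<forall>f2\<in>hom C a b.
        on_Arr \<gamma> f1 = on_Arr \<gamma> f2 \<longrightarrow> \<chi> (g \<cdot>\<^bsub>C\<^esub> f1) = \<chi> (g \<cdot>\<^bsub>C\<^esub> f2)"
      if \<chi>: "coloring r (hom C a c3) \<chi>" for \<chi> :: "'m \<Rightarrow> nat"
    proof -
      \<comment> \<open>(P) for \<delta> is applied to \<open>\<chi> \<circ> \<zeta>\<close>. Its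
        \<open>g\<close> serves all pairs \<open>h1\<close>, \<open>h2\<close> at once, so they may
        later be taken as values of \<phi> that themselves involve \<open>g\<close>.\<close>
      obtain g where g: "g \<in> hom D d2 d3"
        and mono: "\<And>h1 h2. \<lbrakk>h1 \<in> hom D d1 d2; h2 \<in> hom D d1 d2;
          on_Arr \<delta> h1 = on_Arr \<delta> h2\<rbrakk> \<Longrightarrow> \<chi> (\<zeta> (g \<cdot>\<^bsub>D\<^esub> h1)) = \<chi> (\<zeta> (g \<cdot>\<^bsub>D\<^esub> h2))"
        using P[OF coloring_compose[OF \<chi> \<zeta>]] by auto
      show ?thesis
      proof (intro bexI[OF _ \<psi>[OF g]] ballI impI)
        fix f1 f2
        assume f: "f1 \<in> hom C a b" "f2 \<in> hom C a b" and eq: "on_Arr \<gamma> f1 = on_Arr \<gamma> f2"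
        show "\<chi> (\<psi> g \<cdot>\<^bsub>C\<^esub> f1) = \<chi> (\<psi> g \<cdot>\<^bsub>C\<^esub> f2)"
          \<comment> \<open>Take \<open>h1\<close> = \<phi> \<open>(f1, g)\<close> and
            \<open>h2\<close> = \<phi> \<open>(f2, g)\<close>: their \<delta>-values agree by
            \<open>compat\<close>, and \<open>\<zeta>_eq\<close> rewrites the two colors into those
            of the goal.\<close>
          using mono[OF \<phi>[OF f(1) g] \<phi>[OF f(2) g] compat[OF f g eq]]
          by (simp add: \<zeta>_eq f g)
      qed
    qed
    with c3 show ?thesis by blast
  qed
  then show ?thesis by (simp add: fulfills_P_def)
qed

end
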